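(* Let $i\geq 1$ be an integer and $j=i+1$. If the weighted pair $(G,\mathbf t)$ is $(i,i+1)$-critical, then $\rho(G,\mathbf t)\leq -1$.
   Context: Multigraphs are finite without loops. A 2-fold cover of a multigraph $G$ is a pair $(L,\mathcal H)$ where $\mathcal H$ is a graph and $L$ assigns to each $v\in V(G)$ a 2-element set $L(v)=\{p(v),r(v)\}$ ($p(v)$ poor, $r(v)$ rich) such that the sets $L(v)$ partition $V(\mathcal H)$, $p(v)r(v)\in E(\mathcal H)$, edges of $\mathcal H$ between $L(u)$ and $L(v)$ ($u\ne v$) exist only if $uv\in E(G)$, and if $u,v$ are joined by $k\ge1$ edges then $\mathcal H[L(u),L(v)]$ is a union of at most $k$ perfect matchings between $L(u)$ and $L(v)$. An $\mathcal H$-map is a function $\phi$ with $\phi(v)\in L(v)$; $\mathcal H_\phi$ is the subgraph of $\mathcal H$ induced by $\phi(V(G))$. Here a toughness function on $G$ maps each $v$ to a pair $\mathbf t(v)=(\mathbf t_p(v),\mathbf t_r(v))$ with $\mathbf t_p(v)\in\{0,\dots,i+1\}$ and $\mathbf t_r(v)\in\{0,\dots,j+1\}$. An $(i,j,\mathbf t)$-coloring of a cover $\mathcal H$ is an $\mathcal H$-map $\phi$ such that if $\phi(v)=p(v)$ its degree in $\mathcal H_\phi$ is at most $i-\mathbf t_p(v)$, and if $\phi(v)=r(v)$ its degree in $\mathcal H_\phi$ is at most $j-\mathbf t_r(v)$ (a negative bound forbids that choice). $(G,\mathbf t)$ is $(i,j)$-critical if some 2-fold cover of $G$ has no $(i,j,\mathbf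 t)$-coloring but for every proper subgraph $G'$ of $G$, every 2-fold cover of $G'$ has an $(i,j,\mathbf t|_{V(G')})$-coloring. Potentials: $\rho_{G,\mathbf t}(v)=2i^2+4i+1-(i+1)\mathbf t_p(v)-i\,\mathbf t_r(v)$ if $\mathbf t_p(v)\ge \mathbf t_r(v)$, and $\rho_{G,\mathbf t}(v)=2i^2+4i+1-i\,\mathbf t_p(v)-(i+1)\mathbf t_r(v)$ if $\mathbf t_p(v)<\mathbf t_r(v)$; for $S\subseteq V(G)$, $\rho_{G,\mathbf t}(S)=\sum_{v\in S}\rho_{G,\mathbf t}(v)-(i^2+3i+1)|E(G[S])|$ (edges with multiplicity); $\rho(G,\mathbf t)=\min_{\emptyset\neq S\subseteq V(G)}\rho_{G,\mathbf t}(S)$. *)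

theory Defs
  imports Main "HOL-Library.Multiset" "HOL-Library.Disjoint_Sets"
begin

record 'v multigraph =
  verts :: "'v set"
  edges :: "'v set multiset"

definition multigraph :: "'v multigraph \<Rightarrow> bool" where
  "multigraph G \<longleftrightarrow>
     finite (verts G) \<and> (\<forall>e \<in># edges G. e \<subseteq> verts G \<and> card e = 2)"

definition proper_subgraph :: "'v multigraph \<Rightarrow> 'v multigraph \<Rightarrow> bool" where
  "proper_subgraph G' G \<longleftrightarrow>
     multigraph G' \<and> verts G' \<subseteq> verts G \<and> edges G' \<subseteq># edges G \<and> G' \<noteq> G"

definition induced_multigraph :: "'v multigraph \<Rightarrow> 'v set \<Rightarrow> 'v multigraph" where
  "induced_multigraph G S = \<lparr> verts = S, edges = filter_mset (\<lambda>e. e \<subseteq> S) (edges G) \<rparr>"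

record 'w sgraph =
  sverts :: "'w set"
  sedges :: "'w set set"

definition sgraph :: "'w sgraph \<Rightarrow> bool" where
  "sgraph H \<longleftrightarrow>
     finite (sverts H) \<and> (\<forall>e \<in> sedges H. e \<subseteq> sverts H \<and> card e = 2)"

definition induced_sgraph :: "'w sgraph \<Rightarrow> 'w set \<Rightarrow> 'w sgraph" where
  "induced_sgraph H X = \<lparr> sverts = X, sedges = {e \<in> sedges H. e \<subseteq> X} \<rparr>"

definition degree :: "'w sgraph \<Rightarrow> 'w \<Rightarrow> nat" where
  "degree H x = card {e \<in> sedges H. x \<in> e}"

definition edges_between :: "'w sgraph \<Rightarrow> 'w set \<Rightarrow> 'w set \<Rightarrow> 'w set set" where
  "edges_between H A B = {e \<in> sedges H. \<exists>a\<in>A. \<exists>b\<in>B. e = {a, b}}"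

definition perfect_matching_between :: "'w set \<Rightarrow> 'w set \<Rightarrow> 'w set set \<Rightarrow> bool" where
  "perfect_matching_between A B M \<longleftrightarrow>
     (\<forall>e\<in>M. \<exists>a\<in>A. \<exists>b\<in>B. e = {a, b}) \<and> (\<forall>x \<in> A \<union> B. \<exists>!e. e \<in> M \<and> x \<in> e)"

record ('v, 'w) cover =
  poor :: "'v \<Rightarrow> 'w"
  rich :: "'v \<Rightarrow> 'w"
  cgraph :: "'w sgraph"

definition L :: "('v, 'w) cover \<Rightarrow> 'v \<Rightarrow> 'w set" where
  "L C v = {poor C v, rich C v}"

definition two_fold_cover :: "'v multigraph \<Rightarrow> ('v, 'w) cover \<Rightarrow> bool" where
  "two_fold_cover G C \<longleftrightarrow>
     sgraph (cgraph C) \<and>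
     (\<forall>v \<in> verts G. poor C v \<noteq> rich C v) \<and>
     disjoint_family_on (L C) (verts G) \<and>
     (\<Union>v \<in> verts G. L C v) = sverts (cgraph C) \<and>
     (\<forall>v \<in> verts G. {poor C v, rich C v} \<in> sedges (cgraph C)) \<and>
     (\<forall>u \<in> verts G. \<forall>v \<in> verts G. u \<noteq> v \<longrightarrow>
        edges_between (cgraph C) (L C u) (L C v) \<noteq> {} \<longrightarrow> {u, v} \<in># edges G) \<and>
     (\<forall>u \<in> verts G. \<forall>v \<in> verts G. u \<noteq> v \<longrightarrow> count (edges G) {u, v} \<ge> 1 \<longrightarrow>
        (\<exists>\<M>. finite \<M> \<and> card \<M> \<le> count (edges G) {u, v} \<and>
             (\<forall>M \<in> \<M>. perfect_matching_between (L C u) (L C v) M) \<and>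
             edges_between (cgraph C) (L C u) (L C v) = \<Union>\<M>))"

definition cover_map :: "'v multigraph \<Rightarrow> ('v, 'w) cover \<Rightarrow> ('v \<Rightarrow> 'w) \<Rightarrow> bool" where
  "cover_map G C \<phi> \<longleftrightarrow> (\<forall>v \<in> verts G. \<phi> v \<in> L C v)"

definition chosen_subgraph :: "'v multigraph \<Rightarrow> ('v, 'w) cover \<Rightarrow> ('v \<Rightarrow> 'w) \<Rightarrow> 'w sgraph" where
  "chosen_subgraph G C \<phi> = induced_sgraph (cgraph C) (\<phi> ` verts G)"

type_synonym 'v toughness = "'v \<Rightarrow> nat \<times> nat"

abbreviation t_p :: "'v toughness \<Rightarrow> 'v \<Rightarrow> nat" where
  "t_p t v \<equiv> fst (t v)"

abbreviation t_r :: "'v toughness \<Rightarrow> 'v \<Rightarrow> nat" where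
  "t_r t v \<equiv> snd (t v)"

definition toughness :: "nat \<Rightarrow> nat \<Rightarrow> 'v multigraph \<Rightarrow> 'v toughness \<Rightarrow> bool" where
  "toughness i j G t \<longleftrightarrow> (\<forall>v \<in> verts G. t_p t v \<le> i + 1 \<and> t_r t v \<le> j + 1)"

text \<open>The degree bounds are compared in the integers, so that a negative bound forbids the choice.\<close>

definition coloring ::
  "nat \<Rightarrow> nat \<Rightarrow> 'v toughness \<Rightarrow> 'v multigraph \<Rightarrow> ('v, 'w) cover \<Rightarrow> ('v \<Rightarrow> 'w) \<Rightarrow> bool" where
  "coloring i j t G C \<phi> \<longleftrightarrow>
     cover_map G C \<phi> \<and>
     (\<forall>v \<in> verts G.
        (\<phi> v = poor C v \<longrightarrow>
           int (degree (chosen_subgraph G C \<phi>) (\<phi> v)) \<le> int i - int (t_p t v)) \<and>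
        (\<phi> v = rich C v \<longrightarrow>
           int (degree (chosen_subgraph G C \<phi>) (\<phi> v)) \<le> int j - int (t_r t v)))"

text \<open>
  The type argument is the type of the vertices of the cover graphs. It is left arbitrary:
  the first conjunct forces it to have at least twice as many elements as \<open>verts G\<close>, and then
  every 2-fold cover of \<open>G\<close> or of a subgraph of \<open>G\<close>, over whatever type, is isomorphic to one over
  it. The restriction of \<open>t\<close> to \<open>verts G'\<close> is \<open>t\<close> itself, since \<open>coloring\<close> only uses \<open>t\<close> there.
\<close>

definition critical ::
  "'w itself \<Rightarrow> nat \<Rightarrow> nat \<Rightarrow> 'v multigraph \<Rightarrow> 'v toughness \<Rightarrow> bool" where
  "critical W i j G t \<longleftrightarrow>
     (\<exists>C :: ('v, 'w) cover. two_fold_cover G C \<and> \<not> (\<exists>\<phi>. coloring i j t G C \<phi>)) \<and>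
     (\<forall>G'. proper_subgraph G' G \<longrightarrow>
        (\<forall>C :: ('v, 'w) cover. two_fold_cover G' C \<longrightarrow> (\<exists>\<phi>. coloring i j t G' C \<phi>)))"

definition vertex_potential :: "nat \<Rightarrow> 'v toughness \<Rightarrow> 'v \<Rightarrow> int" where
  "vertex_potential i t v =
     (if t_p t v \<ge> t_r t v
      then 2 * (int i)^2 + 4 * int i + 1 - (int i + 1) * int (t_p t v) - int i * int (t_r t v)
      else 2 * (int i)^2 + 4 * int i + 1 - int i * int (t_p t v) - (int i + 1) * int (t_r t v))"

definition set_potential :: "nat \<Rightarrow> 'v multigraph \<Rightarrow> 'v toughness \<Rightarrow> 'v set \<Rightarrow> int" where
  "set_potential i G t S =
     (\<Sum>v\<in>S. vertex_potential i t v)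
       - ((int i)^2 + 3 * int i + 1) * int (size (edges (induced_multigraph G S)))"

definition potential :: "nat \<Rightarrow> 'v multigraph \<Rightarrow> 'v toughness \<Rightarrow> int" where
  "potential i G t = Min (set_potential i G t ` {S. S \<noteq> {} \<and> S \<subseteq> verts G})"

end

theory Submission
  imports Defs
begin

text \<open>Write \<open>A v = i + 1 - t\<^sub>p v\<close> and \<open>B v = i + 2 - t\<^sub>r v\<close>; a poor (rich) vertex must have fewer
  than \<open>A v\<close> (\<open>B v\<close>) conflicts. A 2-fold cover is a signed graph whose vertices are coloured
  poor/rich, an edge being in conflict if its ends agree (positive sign) or disagree (negative
  sign). The stronger claim proved by induction on the number of vertices is that a colouring exists
  whenever every nonempty set has nonnegative potential with respect to the larger vertex
  potential \<open>(i + 1) A + i B - [B \<le> A]\<close>.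

  Forbidding a colour at a vertex costs at most \<open>(i + 1)\<^sup>2\<close>, which is \<open>i\<close> less than an edge. So
  colouring a proper set of least potential first and forbidding the conflicting colours outside
  shows that in a minimal counterexample proper sets have potential at least \<open>i + 1\<close>; then no cut
  consists of one edge, and the same argument gives \<open>2 i + 1\<close>. Now a vertex with positive
  capacities and degree at most \<open>max A B\<close> can be deleted, each of its edges reducing one capacity
  of the other end by one. Hence all degrees are so large that, after every edge is split evenly
  between its ends, each vertex has negative charge.\<close>

section \<open>Arithmetic of the capacity potential\<close>

definition cap_potential :: "nat \<Rightarrow> nat \<Rightarrow> nat \<Rightarrow> int" where
  "cap_potential i a b = (int i + 1) * int a + int i * int b - (if b \<le> a then 1 else 0)"

lemma cap_potential_le_full:
  assumes "a \<le> i + 1" "b \<le> i + 2"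
  shows "cap_potential i a b \<le> 2 * (int i)\<^sup>2 + 4 * int i + 1"
proof -
  have "(int i + 1) * int a \<le> (int i + 1) * (int i + 1)" "int i * int b \<le> int i * (int i + 2)"
    using assms by (auto intro!: mult_left_mono)
  then show ?thesis
    by (auto simp: cap_potential_def algebra_simps power2_eq_square)
qed

text \<open>Missing any unit of capacity costs at least 1 against the maximum;
  \<open>degree_gt\<close> needs this 1 for a pair of edges.\<close>

lemma cap_potential_less_full:
  assumes "i \<ge> 1" "a \<le> i + 1" "b \<le> i + 2" "\<not> (a = i + 1 \<and> b = i + 2)"
  shows "cap_potential i a b \<le> 2 * (int i)\<^sup>2 + 4 * int i"
proof (cases "a = i + 1")
  case True
  then have "b \<le> i + 1" using assms by auto
  then have "int i * int b \<le> int i * (int i + 1)" by (intro mult_left_mono) auto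
  with True assms(1) show ?thesis
    by (auto simp: cap_potential_def algebra_simps power2_eq_square)
next
  case False
  then have "a \<le> i" using assms by auto
  then have "(int i + 1) * int a \<le> (int i + 1) * int i" "int i * int b \<le> int i * (int i + 2)"
    using assms by (auto intro!: mult_left_mono)
  with assms(1) show ?thesis
    by (auto simp: cap_potential_def algebra_simps power2_eq_square)
qed

text \<open>Here \<open>m\<close> and \<open>n\<close> count the conflicts that forbid poor and
  rich. A forbidden colour costs at most \<open>(i + 1)\<^sup>2\<close>, so one conflict already
  pays for it.\<close>

lemma cap_potential_forbid:
  assumes "a \<le> i + 1" "b \<le> i + 2"
  shows "cap_potential i (if m > 0 then 0 else a) (if n > 0 then 0 else b)
           \<ge> cap_potential i a b - (int i + 1)\<^sup>2 * int (m + n)"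
proof -
  have a: "(int i + 1) * int a \<le> (int i + 1)\<^sup>2"
    using assms by (auto simp: power2_eq_square intro!: mult_left_mono)
  \<comment> \<open>The extra 1 pays for the correction term, which can appear when the rich
    capacity drops to 0.\<close>
  have b: "int i * int b + 1 \<le> (int i + 1)\<^sup>2"
  proof -
    have "int i * int b \<le> int i * (int i + 2)"
      using assms by (auto intro!: mult_left_mono)
    then show ?thesis by (auto simp: algebra_simps power2_eq_square)
  qed
  define P Q where "P = (int i + 1)\<^sup>2 * int m" and "Q = (int i + 1)\<^sup>2 * int n"
  have "(int i + 1)\<^sup>2 \<le> (int i + 1)\<^sup>2 * int k" if "k > 0" for k
    using mult_left_mono[of 1 "int k" "(int i + 1)\<^sup>2"] that by auto
  then have "m > 0 \<Longrightarrow> (int i + 1)\<^sup>2 \<le> P" "n > 0 \<Longrightarrow> (int i + 1)\<^sup>2 \<le> Q"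
    unfolding P_def Q_def by blast+
  moreover have "m = 0 \<Longrightarrow> P = 0" "n = 0 \<Longrightarrow> Q = 0" by (auto simp: P_def Q_def)
  moreover have "(int i + 1)\<^sup>2 * int (m + n) = P + Q"
    by (simp add: P_def Q_def algebra_simps)
  ultimately show ?thesis
    using a b by (cases "m > 0"; cases "n > 0") (auto simp: cap_potential_def)
qed

text \<open>Lowering \<open>a\<close> costs \<open>i + 1\<close> and can only remove the correction;
  lowering \<open>b\<close> costs \<open>i\<close> and can add the correction 1.\<close>

lemma cap_potential_Suc:
  "cap_potential i (a - 1) b \<ge> cap_potential i a b - (int i + 1)"
  "cap_potential i a (b - 1) \<ge> cap_potential i a b - (int i + 1)"
  by (cases a; cases b; auto simp: cap_potential_def algebra_simps)+

lemma cap_potential_diff: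
  "cap_potential i (a - m) (b - n) \<ge> cap_potential i a b - (int i + 1) * int (m + n)"
proof (induction m)
  case 0
  show ?case
  proof (induction n)
    case (Suc n)
    then show ?case
      using cap_potential_Suc(2)[of i a "b - n"] by (auto simp: algebra_simps)
  qed simp
next
  case (Suc m)
  then show ?case
    using cap_potential_Suc(1)[of i "a - m" "b - n"] by (auto simp: algebra_simps)
qed

text \<open>If both capacities are positive, their comparison and hence the correction stay the
  same, so the cost is \<open>(i + 1) + i\<close>, one less than for two separate steps.\<close>

lemma cap_potential_diff_both:
  assumes "i \<ge> 1"
  shows "cap_potential i (a - 1) (b - 1) \<ge> cap_potential i a b - (2 * int i + 1)"
  using assms by (cases a; cases b) (auto simp: cap_potential_def algebra_simps)

text \<open>With one positive capacity, \<open>d\<close> is at least that capacity and the edge cost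
  is at least \<open>2 * i + 2\<close>. With two, \<open>d\<close> exceeds their maximum
  \<open>k\<close>, and the potential is at most \<open>(2 * i + 1) * k\<close>.\<close>

lemma cap_potential_discharge:
  assumes i: "i \<ge> 1" and ab: "a \<le> i + 1" "b \<le> i + 2" and pos: "a \<ge> 1 \<or> b \<ge> 1"
    and d: "a \<le> d" "b \<le> d" "a \<ge> 1 \<Longrightarrow> b \<ge> 1 \<Longrightarrow> a < d \<and> b < d"
  shows "2 * cap_potential i a b < ((int i)\<^sup>2 + 3 * int i + 1) * int d"
proof -
  let ?E = "(int i)\<^sup>2 + 3 * int i + 1"
  have mono: "?E * int k \<le> ?E * int d" if "k \<le> d" for k
    using that by (intro mult_left_mono) auto
  have "1 * int i \<le> int i * int i" using i by (intro mult_right_mono) auto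
  then have E: "2 * int i + 2 \<le> ?E" using i unfolding power2_eq_square by linarith
  consider "b = 0" "a \<ge> 1" | "a = 0" "b \<ge> 1" | "a \<ge> 1" "b \<ge> 1"
    using pos by (cases a; cases b) auto
  then show ?thesis
  proof cases
    case 1
    have "(2 * int i + 2) * int a \<le> ?E * int a"
      by (rule mult_right_mono[OF E]) simp
    with mono[OF d(1)] 1 show ?thesis by (auto simp: cap_potential_def algebra_simps)
  next
    case 2
    have "(2 * int i) * int b < ?E * int b"
      using E 2 by (intro mult_strict_right_mono) auto
    with mono[OF d(2)] 2 show ?thesis by (auto simp: cap_potential_def algebra_simps)
  next
    case 3
    define k where "k = max a b"
    have k: "k + 1 \<le> d" "a \<le> k" "b \<le> k" "1 \<le> k" "k \<le> i + 2"
      using 3 d ab by (auto simp: k_def)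
    have "(int i + 1) * int a \<le> (int i + 1) * int k" "int i * int b \<le> int i * int k"
      using k by (auto intro!: mult_left_mono)
    then have g: "cap_potential i a b \<le> (2 * int i + 1) * int k"
      by (auto simp: cap_potential_def algebra_simps)
    \<comment> \<open>For \<open>i = 1\<close> this reads \<open>6 * k < 5 * (k + 1)\<close>, true
      since \<open>k \<le> 3\<close>; for larger \<open>i\<close> the edge cost is at least
      \<open>4 * i + 2\<close>.\<close>
    have "2 * ((2 * int i + 1) * int k) < ?E * (int k + 1)"
    proof (cases "i = 1")
      case True
      with k show ?thesis by simp
    next
      case False
      then have "2 * int i \<le> int i * int i" using i by (intro mult_right_mono) auto
      then have "4 * int i + 2 \<le> ?E"
        using False i unfolding power2_eq_square by linarith
      then have "(4 * int i + 2) * int k \<le> ?E * int k" by (rule mult_right_mono) simp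
      moreover have "?E > 0" by (simp add: add_nonneg_pos)
      ultimately show ?thesis by (simp add: algebra_simps)
    qed
    with g mono[OF k(1)] show ?thesis by (simp add: algebra_simps)
  qed
qed

section \<open>Signed graphs, capacities and potentials\<close>

text \<open>\<open>w u v s\<close> is the number of edges between \<open>u\<close> and \<open>v\<close> that are in conflict when the truth value
  of \<open>\<phi> u = \<phi> v\<close> is \<open>s\<close>; the colour \<open>True\<close> stands for rich.\<close>

locale signed_graph =
  fixes i :: nat and w :: "'v \<Rightarrow> 'v \<Rightarrow> bool \<Rightarrow> nat"
  assumes i_pos: "i \<ge> 1"
    and w_sym: "w u v s = w v u s"
    and w_irrefl: "w v v s = 0"
begin

definition emult :: "'v \<Rightarrow> 'v \<Rightarrow> nat" where
  "emult u v = w u v True + w u v False"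

definition cross :: "'v set \<Rightarrow> 'v set \<Rightarrow> nat" where
  "cross S T = (\<Sum>u\<in>S. \<Sum>v\<in>T. emult u v)"

text \<open>\<open>cross S S\<close> meets each edge from both ends; by
  \<open>even_cross_self\<close> the halving is exact for finite \<open>S\<close>.\<close>

definition num_edges :: "'v set \<Rightarrow> nat" where
  "num_edges S = cross S S div 2"

text \<open>The colour \<open>b\<close> tested at \<open>v\<close> is independent of
  \<open>\<phi> v\<close>, so \<open>v\<close> may lie outside \<open>S\<close>; inside, its own
  term is 0.\<close>

definition conflicts :: "('v \<Rightarrow> bool) \<Rightarrow> 'v set \<Rightarrow> bool \<Rightarrow> 'v \<Rightarrow> nat" where
  "conflicts \<phi> S b v = (\<Sum>u\<in>S. w u v (\<phi> u = b))"

text \<open>Capacities are one above the degree bounds, so 0 forbids a colour and natural numbers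
  suffice.\<close>

definition good :: "('v \<Rightarrow> bool \<Rightarrow> nat) \<Rightarrow> 'v set \<Rightarrow> ('v \<Rightarrow> bool) \<Rightarrow> bool" where
  "good c S \<phi> \<longleftrightarrow> (\<forall>v\<in>S. conflicts \<phi> S (\<phi> v) v < c v (\<phi> v))"

definition vpot :: "('v \<Rightarrow> bool \<Rightarrow> nat) \<Rightarrow> 'v \<Rightarrow> int" where
  "vpot c v = cap_potential i (c v False) (c v True)"

abbreviation edge_cost :: int where
  "edge_cost \<equiv> (int i)\<^sup>2 + 3 * int i + 1"

definition pot :: "('v \<Rightarrow> bool \<Rightarrow> nat) \<Rightarrow> 'v set \<Rightarrow> int" where
  "pot c S = (\<Sum>v\<in>S. vpot c v) - edge_cost * int (num_edges S)"

definition admissible :: "('v \<Rightarrow> bool \<Rightarrow> nat) \<Rightarrow> 'v set \<Rightarrow> bool" where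
  "admissible c S \<longleftrightarrow> (\<forall>v\<in>S. c v False \<le> i + 1 \<and> c v True \<le> i + 2) \<and>
     (\<forall>U. U \<noteq> {} \<longrightarrow> U \<subseteq> S \<longrightarrow> 0 \<le> pot c U)"

lemma emult_sym: "emult u v = emult v u"
  using w_sym by (simp add: emult_def)

lemma emult_irrefl: "emult v v = 0"
  by (simp add: emult_def w_irrefl)

lemma cross_sym: "cross S T = cross T S"
  unfolding cross_def by (subst sum.swap) (rule sum.cong[OF refl sum.cong[OF refl emult_sym]])

lemma cross_Un_right:
  assumes "finite T" "finite T'" "T \<inter> T' = {}"
  shows "cross S (T \<union> T') = cross S T + cross S T'"
  using assms by (simp add: cross_def sum.union_disjoint sum.distrib)

lemma cross_Un_self:
  assumes "finite S" "finite T" "S \<inter> T = {}"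
  shows "cross (S \<union> T) (S \<union> T) = cross S S + cross T T + 2 * cross S T"
proof -
  have "cross (S \<union> T) (S \<union> T) = cross S (S \<union> T) + cross T (S \<union> T)"
    using assms by (simp add: cross_Un_right cross_sym[of "S \<union> T" S] cross_sym[of "S \<union> T" T])
  then show ?thesis
    using assms by (simp add: cross_Un_right cross_sym[of T S])
qed

lemma even_cross_self: "finite S \<Longrightarrow> even (cross S S)"
proof (induction S rule: finite_induct)
  case empty
  show ?case by (simp add: cross_def)
next
  case (insert v S)
  then have "cross (insert v S) (insert v S) = cross S S + cross {v} {v} + 2 * cross S {v}"
    using cross_Un_self[of S "{v}"] by simp
  with insert show ?case by (simp add: cross_def[of "{v}"] emult_irrefl)
qed

lemma double_num_edges: "finite S \<Longrightarrow> 2 * num_edges S = cross S S"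
  unfolding num_edges_def using even_cross_self by simp

lemma num_edges_Un:
  assumes "finite S" "finite T" "S \<inter> T = {}"
  shows "num_edges (S \<union> T) = num_edges S + num_edges T + cross S T"
  using cross_Un_self[OF assms] double_num_edges[of S] double_num_edges[of T]
    double_num_edges[of "S \<union> T"] assms by simp

lemma num_edges_empty: "num_edges {} = 0"
  by (simp add: num_edges_def cross_def)

lemma num_edges_insert:
  assumes "finite S" "v \<notin> S"
  shows "num_edges (insert v S) = num_edges S + (\<Sum>u\<in>S. emult u v)"
  using num_edges_Un[of S "{v}"] assms
  by (simp add: num_edges_def[of "{v}"] cross_def emult_irrefl)

lemma pot_Un:
  assumes "finite S" "finite T" "S \<inter> T = {}"
  shows "pot c (S \<union> T) = pot c S + pot c T - edge_cost * int (cross S T)"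
  using assms by (simp add: pot_def num_edges_Un sum.union_disjoint algebra_simps)

lemma pot_singleton: "pot c {v} = vpot c v"
  by (simp add: pot_def num_edges_def cross_def emult_irrefl)

lemma double_pot:
  assumes "finite V"
  shows "2 * pot c V = (\<Sum>v\<in>V. 2 * vpot c v - edge_cost * int (cross {v} V))"
proof -
  have "(\<Sum>v\<in>V. int (cross {v} V)) = 2 * int (num_edges V)"
    using double_num_edges[OF assms] by (simp add: cross_def flip: of_nat_sum)
  then have "edge_cost * (\<Sum>v\<in>V. int (cross {v} V)) = 2 * (edge_cost * int (num_edges V))"
    by simp
  then show ?thesis
    by (simp add: pot_def sum_subtractf sum_distrib_left right_diff_distrib)
qed

lemma pot_change:
  assumes "\<And>v. v \<in> U \<Longrightarrow> vpot c' v \<ge> vpot c v - f v"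
  shows "pot c' U \<ge> pot c U - (\<Sum>v\<in>U. f v)"
proof -
  have "(\<Sum>v\<in>U. vpot c v - f v) \<le> (\<Sum>v\<in>U. vpot c' v)"
    using assms by (intro sum_mono)
  then show ?thesis by (simp add: pot_def sum_subtractf)
qed

text \<open>Each edge from \<open>S\<close> to \<open>v\<close> is in conflict with exactly one of
  the two colours of \<open>v\<close>.\<close>

lemma conflicts_both: "conflicts \<phi> S True v + conflicts \<phi> S False v = cross S {v}"
proof -
  have "w u v (\<phi> u = True) + w u v (\<phi> u = False) = emult u v" for u
    by (cases "\<phi> u") (auto simp: emult_def)
  then show ?thesis
    by (simp add: conflicts_def cross_def flip: sum.distrib)
qed

lemma conflicts_le_cross: "conflicts \<phi> S b v \<le> cross S {v}"
  using conflicts_both[of \<phi> S v] by (cases b) auto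

lemma conflicts_Un:
  assumes "finite S" "finite T" "S \<inter> T = {}"
  shows "conflicts \<phi> (S \<union> T) b v = conflicts \<phi> S b v + conflicts \<phi> T b v"
  using assms by (simp add: conflicts_def sum.union_disjoint)

lemma conflicts_cong:
  assumes "\<And>u. u \<in> S \<Longrightarrow> \<phi> u = \<psi> u"
  shows "conflicts \<phi> S b v = conflicts \<psi> S b v"
  using assms by (simp add: conflicts_def)

lemma good_Un:
  assumes fin: "finite S" "finite T" and disj: "S \<inter> T = {}"
    and S: "\<And>v. v \<in> S \<Longrightarrow> conflicts \<phi> S (\<phi> v) v + conflicts \<psi> T (\<phi> v) v < c v (\<phi> v)"
    and T: "\<And>v. v \<in> T \<Longrightarrow> conflicts \<phi> S (\<psi> v) v + conflicts \<psi> T (\<psi> v) v < c v (\<psi> v)"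
  shows "\<exists>\<chi>. good c (S \<union> T) \<chi>"
proof -
  define \<chi> where "\<chi> v = (if v \<in> S then \<phi> v else \<psi> v)" for v
  have "conflicts \<chi> S b v = conflicts \<phi> S b v" "conflicts \<chi> T b v = conflicts \<psi> T b v" for b v
    by (rule conflicts_cong, use disj in \<open>auto simp: \<chi>_def\<close>)+
  then have "good c (S \<union> T) \<chi>"
    using S T disj unfolding good_def by (auto simp: conflicts_Un[OF fin disj] \<chi>_def)
  then show ?thesis by blast
qed

lemma admissible_subset: "admissible c V \<Longrightarrow> S \<subseteq> V \<Longrightarrow> admissible c S"
  by (auto simp: admissible_def)

lemma admissible_reduce:
  assumes adm: "admissible c V" and S: "S \<subseteq> V"
    and le: "\<And>v b. c' v b \<le> c v b"
    and pot: "\<And>U. U \<noteq> {} \<Longrightarrow> U \<subseteq> S \<Longrightarrow> 0 \<le> pot c' U"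
  shows "admissible c' S"
  using adm S pot le order_trans unfolding admissible_def by (meson subsetD)

end

section \<open>Minimal counterexamples and the potential of proper sets\<close>

text \<open>Minimality covers all capacity functions \<open>c'\<close>, since the reductions lower
  capacities on the remaining vertices.\<close>

locale minimal_counterexample = signed_graph i w
  for i :: nat and w :: "'v \<Rightarrow> 'v \<Rightarrow> bool \<Rightarrow> nat" +
  fixes V :: "'v set" and c :: "'v \<Rightarrow> bool \<Rightarrow> nat"
  assumes fin: "finite V" and adm: "admissible c V"
    and uncol: "\<not> good c V \<phi>"
    and smaller: "S \<subset> V \<Longrightarrow> admissible c' S \<Longrightarrow> \<exists>\<phi>. good c' S \<phi>"
begin

lemma fin_subset: "S \<subseteq> V \<Longrightarrow> finite S"
  using fin finite_subset by blast

lemma pot_nonneg: "U \<noteq> {} \<Longrightarrow> U \<subseteq> V \<Longrightarrow> 0 \<le> pot c U"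
  using adm by (simp add: admissible_def)

lemma cap_le: "v \<in> V \<Longrightarrow> c v False \<le> i + 1" "v \<in> V \<Longrightarrow> c v True \<le> i + 2"
  using adm by (auto simp: admissible_def)

lemma not_good_Un:
  assumes "S \<subseteq> V"
    and "\<And>v. v \<in> S \<Longrightarrow> conflicts \<phi> S (\<phi> v) v + conflicts \<psi> (V - S) (\<phi> v) v < c v (\<phi> v)"
    and "\<And>v. v \<in> V - S \<Longrightarrow> conflicts \<phi> S (\<psi> v) v + conflicts \<psi> (V - S) (\<psi> v) v < c v (\<psi> v)"
  shows False
  using good_Un[of S "V - S" \<phi> \<psi> c] assms uncol fin_subset[of S] fin
  by (simp add: Un_absorb1)

lemma weight_le_conflicts:
  assumes "finite S" "u \<in> S"
  shows "w u v (\<phi> u = b) \<le> conflicts \<phi> S b v"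
  using assms by (auto simp: conflicts_def intro: member_le_sum)

text \<open>Otherwise colour \<open>S\<close> and forbid outside every colour in conflict with it. A
  crossing edge then costs at most \<open>(i + 1)\<^sup>2 = edge_cost - i\<close>, so the rest stays
  admissible and the two colourings fit together.\<close>

lemma exists_low_union:
  assumes S: "S \<subset> V" "S \<noteq> {}"
  shows "\<exists>U. U \<noteq> {} \<and> U \<subseteq> V - S \<and> pot c (S \<union> U) - pot c S + int i * int (cross S U) < 0"
proof (rule ccontr)
  assume neg: "\<not> ?thesis"
  obtain \<phi> where \<phi>: "good c S \<phi>"
    using smaller[OF S(1)] admissible_subset[OF adm] S by blast
  define c' where "c' v b = (if conflicts \<phi> S b v > 0 then 0 else c v b)" for v b
  have "admissible c' (V - S)"
  proof (rule admissible_reduce[OF adm])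
    fix U assume U: "U \<noteq> {}" "U \<subseteq> V - S"
    then have fU: "finite U" "finite S" "S \<inter> U = {}"
      using S fin_subset[of U] fin_subset[of S] by auto
    have "pot c' U \<ge> pot c U - (\<Sum>v\<in>U. (int i + 1)\<^sup>2 * int (cross S {v}))"
    proof (rule pot_change)
      fix v assume "v \<in> U"
      then have v: "v \<in> V" using U by auto
      show "vpot c' v \<ge> vpot c v - (int i + 1)\<^sup>2 * int (cross S {v})"
        using cap_potential_forbid[OF cap_le(1)[OF v] cap_le(2)[OF v],
            of "conflicts \<phi> S False v" "conflicts \<phi> S True v"]
        unfolding vpot_def c'_def by (metis add.commute conflicts_both)
    qed
    moreover have "(\<Sum>v\<in>U. int (cross S {v})) = int (cross S U)"
      by (simp add: cross_def sum.swap[of _ S U])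
    then have "(\<Sum>v\<in>U. (int i + 1)\<^sup>2 * int (cross S {v})) = (int i + 1)\<^sup>2 * int (cross S U)"
      by (simp flip: sum_distrib_left)
    ultimately have "pot c' U \<ge> pot c U - (int i + 1)\<^sup>2 * int (cross S U)" by simp
    moreover have "pot c U = pot c (S \<union> U) - pot c S + edge_cost * int (cross S U)"
      using pot_Un[of S U c] fU by simp
    ultimately have "pot c' U \<ge> pot c (S \<union> U) - pot c S + int i * int (cross S U)"
      by (simp add: algebra_simps power2_eq_square)
    moreover have "\<not> pot c (S \<union> U) - pot c S + int i * int (cross S U) < 0"
      using neg U by blast
    ultimately show "0 \<le> pot c' U" by linarith
  qed (auto simp: c'_def)
  then obtain \<psi> where \<psi>: "good c' (V - S) \<psi>"
    using smaller[of "V - S" c'] S by blast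
  have T: "conflicts \<phi> S (\<psi> v) v = 0" "conflicts \<psi> (V - S) (\<psi> v) v < c v (\<psi> v)"
    if "v \<in> V - S" for v
    using \<psi> that unfolding good_def c'_def by (force split: if_splits)+
  \<comment> \<open>Conflict is symmetric: a crossing conflict at \<open>v\<close> would also be
    seen from \<open>V - S\<close>, where there is none.\<close>
  have "conflicts \<psi> (V - S) (\<phi> v) v = 0" if v: "v \<in> S" for v
  proof -
    have "w u v (\<psi> u = \<phi> v) = 0" if u: "u \<in> V - S" for u
    proof -
      have "w v u (\<phi> v = \<psi> u) \<le> conflicts \<phi> S (\<psi> u) u"
        using S v fin_subset[of S] by (intro weight_le_conflicts) auto
      then have "w v u (\<phi> v = \<psi> u) = 0" using T(1)[OF u] by simp
      then show ?thesis by (cases "\<phi> v"; cases "\<psi> u") (auto simp: w_sym[of u v])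
    qed
    then show ?thesis by (simp add: conflicts_def)
  qed
  then show False
    using not_good_Un[of S \<phi> \<psi>] S \<phi> T by (auto simp: good_def)
qed

text \<open>Applied to a set of least potential among the proper ones, only the whole complement can
  violate the potential condition, and \<open>k\<close> crossing edges give a surplus of \<open>k i\<close> there.\<close>

lemma proper_pot_gt:
  assumes k: "\<And>S. S \<subset> V \<Longrightarrow> S \<noteq> {} \<Longrightarrow> cross S (V - S) = 0 \<or> k \<le> cross S (V - S)"
    and S: "S \<subset> V" "S \<noteq> {}"
  shows "pot c S > int (k * i)"
proof -
  define P where "P = {S. S \<subset> V \<and> S \<noteq> {}}"
  have "P \<subseteq> Pow V" "P \<noteq> {}" using S by (auto simp: P_def)
  then have "finite P" "P \<noteq> {}" using fin finite_subset by auto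
  then obtain M where M: "M \<in> P" "\<And>T. T \<in> P \<Longrightarrow> pot c M \<le> pot c T"
    using ex_is_arg_min_if_finite[of P "pot c"] by (auto simp: is_arg_min_linorder)
  obtain U where U: "U \<noteq> {}" "U \<subseteq> V - M"
    "pot c (M \<union> U) - pot c M + int i * int (cross M U) < 0"
    using exists_low_union[of M] M(1) unfolding P_def by blast
  have "M \<union> U = V"
  proof (rule ccontr)
    assume "M \<union> U \<noteq> V"
    then have "M \<union> U \<in> P" using M(1) U by (auto simp: P_def)
    moreover have "0 \<le> int i * int (cross M U)" by simp
    ultimately show False using M(2)[of "M \<union> U"] U(3) by linarith
  qed
  then have VU: "U = V - M" using U by auto
  have V: "0 \<le> pot c V" using pot_nonneg[of V] S by auto
  have M': "M \<subset> V" "M \<noteq> {}" using M(1) by (auto simp: P_def)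
  \<comment> \<open>With no crossing edge, potentials add up and the low union would give
    \<open>pot c U < 0\<close>.\<close>
  have "cross M (V - M) \<noteq> 0"
  proof
    assume "cross M (V - M) = 0"
    then have "pot c V = pot c M + pot c U"
      using pot_Un[of M U c] VU \<open>M \<union> U = V\<close> M' fin fin_subset[of M] by auto
    moreover have "0 \<le> pot c U" using pot_nonneg U by blast
    ultimately show False using U(3) VU \<open>M \<union> U = V\<close> \<open>cross M (V - M) = 0\<close> by simp
  qed
  then have "k \<le> cross M U" using k[OF M'] VU by simp
  then have "int i * int k \<le> int i * int (cross M U)" by (intro mult_left_mono) auto
  then have "pot c M > int i * int k" using U(3) V \<open>M \<union> U = V\<close> by simp
  moreover have "pot c M \<le> pot c S" using M(2) S by (auto simp: P_def)
  ultimately show ?thesis by (simp add: mult.commute)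
qed

text \<open>For \<open>k = 1\<close> the hypothesis on cuts is trivial.\<close>

lemma proper_pot_ge: "S \<subset> V \<Longrightarrow> S \<noteq> {} \<Longrightarrow> pot c S \<ge> int i + 1"
  using proper_pot_gt[of 1 S] by fastforce

text \<open>A colouring for the lowered capacity either avoids \<open>b\<close> at \<open>s\<close>
  or leaves room there for one further conflict.\<close>

definition lower :: "'v \<Rightarrow> bool \<Rightarrow> 'v \<Rightarrow> bool \<Rightarrow> nat" where
  "lower s b v d = (if v = s \<and> d = b then c v d - 1 else c v d)"

text \<open>The unit removed costs at most \<open>i + 1\<close>, which every nonempty proper set can
  spare.\<close>

lemma admissible_lower:
  assumes S: "S \<subset> V"
  shows "admissible (lower s b) S"
proof (rule admissible_reduce[OF adm])
  fix U assume U: "U \<noteq> {}" "U \<subseteq> S"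
  have fU: "finite U" using fin_subset[of U] U S by auto
  have "pot (lower s b) U \<ge> pot c U - (\<Sum>v\<in>U. if v = s then int i + 1 else 0)"
  proof (rule pot_change)
    fix v
    show "vpot (lower s b) v \<ge> vpot c v - (if v = s then int i + 1 else 0)"
      using cap_potential_Suc[of i "c v False" "c v True"]
      by (cases b) (auto simp: vpot_def lower_def)
  qed
  moreover have "(\<Sum>v\<in>U. if v = s then int i + 1 else 0) \<le> int i + 1"
    using fU by simp
  moreover have "pot c U \<ge> int i + 1" using proper_pot_ge[of U] U S by auto
  ultimately show "0 \<le> pot (lower s b) U" by linarith
qed (use S in \<open>auto simp: lower_def\<close>)

text \<open>Let the only crossing edge join \<open>s\<close> and \<open>y\<close>. Colourings of the
  two sides with room for a conflict at both ends would glue, so lowering a capacity at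
  \<open>s\<close> makes \<open>s\<close> avoid that colour. Hence the colour of \<open>s\<close>
  can be chosen freely, and the edge can be kept out of conflict.\<close>

lemma cross_neq_1:
  assumes S: "S \<subset> V" "S \<noteq> {}"
  shows "cross S (V - S) \<noteq> 1"
proof
  assume one: "cross S (V - S) = 1"
  let ?T = "V - S"
  have fS: "finite S" "finite ?T" using S fin fin_subset[of S] by auto
  have T: "?T \<subset> V" using S by auto
  have "(\<Sum>(u, v)\<in>S \<times> ?T. emult u v) = Suc 0"
    using one by (simp add: cross_def sum.cartesian_product)
  then obtain s y where sy: "s \<in> S" "y \<in> ?T" "emult s y = 1"
    and others: "\<And>u v. u \<in> S \<Longrightarrow> v \<in> ?T \<Longrightarrow> (u, v) \<noteq> (s, y) \<Longrightarrow> emult u v = 0"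
    using fS sum_eq_Suc0_iff[of "S \<times> ?T" "\<lambda>(u, v). emult u v"] by (fastforce simp: Ball_def)
  then obtain \<sigma> where \<sigma>: "w s y \<sigma> = 1" "w s y (\<not> \<sigma>) = 0"
    by (auto simp: emult_def add_is_1)
  have w_others: "w u v b = 0" if "u \<in> S" "v \<in> ?T" "(u, v) \<noteq> (s, y)" for u v b
    using others[OF that] by (cases b) (auto simp: emult_def)
  have w_sy: "w s y b = (if b = \<sigma> then 1 else 0)" for b
    using \<sigma> by (cases b; cases \<sigma>) auto
  have cS: "conflicts \<psi> ?T b v = (if v = s \<and> (\<psi> y = b) = \<sigma> then 1 else 0)"
    if v: "v \<in> S" for v \<psi> b
  proof -
    have "conflicts \<psi> ?T b v = (\<Sum>u\<in>?T. if u = y then w v y (\<psi> y = b) else 0)"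
      unfolding conflicts_def
      by (intro sum.cong refl) (use v w_others in \<open>auto simp: w_sym[of _ v]\<close>)
    also have "\<dots> = w v y (\<psi> y = b)" using fS sy by simp
    also have "\<dots> = (if v = s \<and> (\<psi> y = b) = \<sigma> then 1 else 0)"
      by (cases "v = s") (use w_others[OF v sy(2)] in \<open>simp_all add: w_sy\<close>)
    finally show ?thesis .
  qed
  have cT: "conflicts \<phi> S b v = (if v = y \<and> (\<phi> s = b) = \<sigma> then 1 else 0)"
    if v: "v \<in> ?T" for v \<phi> b
  proof -
    have "conflicts \<phi> S b v = (\<Sum>u\<in>S. if u = s then w s v (\<phi> s = b) else 0)"
      unfolding conflicts_def
      by (intro sum.cong refl) (use v w_others in auto)
    also have "\<dots> = w s v (\<phi> s = b)" using fS sy by simp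
    also have "\<dots> = (if v = y \<and> (\<phi> s = b) = \<sigma> then 1 else 0)"
      by (cases "v = y") (use w_others[OF sy(1) v] in \<open>simp_all add: w_sy\<close>)
    finally show ?thesis .
  qed
  have flip: "\<exists>\<phi>. good c S \<phi> \<and> \<phi> s = (\<not> b)" for b
  proof -
    obtain \<phi> where \<phi>: "good (lower s b) S \<phi>"
      using smaller[OF S(1) admissible_lower[OF S(1)]] by blast
    have "\<phi> s \<noteq> b"
    proof
      assume b: "\<phi> s = b"
      \<comment> \<open>\<open>b = \<sigma>\<close> is the colour of \<open>y\<close> in conflict
        with \<open>b\<close> at \<open>s\<close>; only its capacity is lowered.\<close>
      obtain \<psi> where \<psi>: "good (lower y (b = \<sigma>)) ?T \<psi>"
        using smaller[OF T admissible_lower[OF T]] by blast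
      show False
      proof (rule not_good_Un[of S \<phi> \<psi>])
        fix v assume v: "v \<in> S"
        then have "conflicts \<phi> S (\<phi> v) v < lower s b v (\<phi> v)"
          using \<phi> by (auto simp: good_def)
        then show "conflicts \<phi> S (\<phi> v) v + conflicts \<psi> ?T (\<phi> v) v < c v (\<phi> v)"
          using cS[OF v] b by (auto simp: lower_def split: if_splits)
      next
        fix v assume v: "v \<in> ?T"
        then have "conflicts \<psi> ?T (\<psi> v) v < lower y (b = \<sigma>) v (\<psi> v)"
          using \<psi> by (auto simp: good_def)
        then show "conflicts \<phi> S (\<psi> v) v + conflicts \<psi> ?T (\<psi> v) v < c v (\<psi> v)"
          using cT[OF v] b by (auto simp: lower_def split: if_splits)
      qed (use S in auto)
    qed
    moreover have "good c S \<phi>"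
      using \<phi> unfolding good_def lower_def by (force split: if_splits)
    ultimately show ?thesis by blast
  qed
  obtain \<psi> where \<psi>: "good c ?T \<psi>"
    using smaller[OF T] admissible_subset[OF adm] by blast
  \<comment> \<open>The colour of \<open>s\<close> in conflict with \<open>\<psi> y\<close> is
    \<open>\<psi> y = \<sigma>\<close>, so its opposite is chosen.\<close>
  obtain \<phi> where \<phi>: "good c S \<phi>" "\<phi> s = (\<not> (\<psi> y = \<sigma>))"
    using flip[of "\<psi> y = \<sigma>"] by blast
  show False
  proof (rule not_good_Un[of S \<phi> \<psi>])
    fix v assume v: "v \<in> S"
    then show "conflicts \<phi> S (\<phi> v) v + conflicts \<psi> ?T (\<phi> v) v < c v (\<phi> v)"
      using \<phi> cS[OF v] by (auto simp: good_def)
  next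
    fix v assume v: "v \<in> ?T"
    then show "conflicts \<phi> S (\<psi> v) v + conflicts \<psi> ?T (\<psi> v) v < c v (\<psi> v)"
      using \<psi> \<phi>(2) cT[OF v] by (auto simp: good_def)
  qed (use S in auto)
qed

text \<open>A cut has 0 or at least 2 edges, so \<open>proper_pot_gt\<close> applies with
  \<open>k = 2\<close>.\<close>

lemma proper_pot_ge_double:
  assumes "S \<subset> V" "S \<noteq> {}"
  shows "pot c S \<ge> 2 * int i + 1"
proof -
  have "cross S (V - S) = 0 \<or> 2 \<le> cross S (V - S)" if "S \<subset> V" "S \<noteq> {}" for S
    using cross_neq_1[OF that] by linarith
  from proper_pot_gt[OF this assms] show ?thesis by simp
qed

section \<open>Degrees in a minimal counterexample\<close>

lemma not_good_insert:
  assumes v: "v \<in> V" and b: "conflicts \<psi> (V - {v}) b v < c v b"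
    and u: "\<And>u. u \<in> V - {v} \<Longrightarrow>
      conflicts \<psi> (V - {v}) (\<psi> u) u + w u v (\<psi> u = b) < c u (\<psi> u)"
  shows False
proof (rule not_good_Un[of "{v}" "\<lambda>_. b" \<psi>])
  fix x assume "x \<in> V - {v}"
  then show "conflicts (\<lambda>_. b) {v} (\<psi> x) x + conflicts \<psi> (V - {v}) (\<psi> x) x < c x (\<psi> x)"
    using u[of x] by (simp add: conflicts_def w_sym[of v x] eq_commute add.commute)
qed (use v b in \<open>auto simp: conflicts_def w_irrefl\<close>)

lemma pot_insert:
  assumes "v \<in> V" "U \<subseteq> V - {v}"
  shows "pot c (insert v U) = pot c U + vpot c v - edge_cost * int (cross U {v})"
  using pot_Un[of U "{v}" c] fin_subset[of U] assms by (auto simp: pot_singleton)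

text \<open>Giving \<open>v\<close> the colour \<open>b\<close> is possible once every other vertex has room for its conflicts
  with that colour; if all edges at \<open>v\<close> are then in conflict, the other colour has none.\<close>

lemma degree_gt:
  assumes v: "v \<in> V"
    and notfull: "\<not> (c v False = i + 1 \<and> c v True = i + 2 \<and> cross (V - {v}) {v} = 2)"
  shows "c v b \<le> cross (V - {v}) {v}"
    and "c v (\<not> b) \<ge> 1 \<Longrightarrow> c v b < cross (V - {v}) {v}"
proof -
  let ?T = "V - {v}"
  define c' where "c' u d = c u d - w u v (d = b)" for u d
  have "admissible c' ?T"
  proof (rule admissible_reduce[OF adm])
    fix U assume U: "U \<noteq> {}" "U \<subseteq> ?T"
    define k where "k = cross U {v}"
    have fU: "finite U" "U \<subset> V" using fin_subset[of U] U v by auto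
    have "pot c' U \<ge> pot c U - (\<Sum>u\<in>U. (int i + 1) * int (emult u v))"
    proof (rule pot_change)
      fix u
      show "vpot c' u \<ge> vpot c u - (int i + 1) * int (emult u v)"
        using cap_potential_diff[of i "c u False" "c u True" "w u v (False = b)" "w u v (True = b)"]
        by (cases b) (simp_all add: vpot_def c'_def emult_def add.commute)
    qed
    moreover have "(\<Sum>u\<in>U. (int i + 1) * int (emult u v)) = (int i + 1) * int k"
      by (simp add: k_def cross_def flip: sum_distrib_left)
    ultimately have p: "pot c' U \<ge> pot c U - (int i + 1) * int k" by simp
    have big: "pot c U \<ge> 2 * int i + 1" using proper_pot_ge_double fU U by auto
    have ins: "pot c U = pot c (insert v U) - vpot c v + edge_cost * int k"
      using pot_insert[OF v U(2)] by (simp add: k_def)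
    have nonneg: "pot c (insert v U) \<ge> 0" using pot_nonneg[of "insert v U"] v U by auto
    have full: "vpot c v \<le> 2 * (int i)\<^sup>2 + 4 * int i + 1"
      unfolding vpot_def by (rule cap_potential_le_full[OF cap_le(1)[OF v] cap_le(2)[OF v]])
    \<comment> \<open>The bound \<open>2 * i + 1\<close> pays for at most one edge to
      \<open>v\<close>. Otherwise \<open>v\<close> is added to \<open>U\<close>: three or more edges
      suffice, while two may leave one unit missing if \<open>v\<close> is full.\<close>
    consider "k \<le> 1" | "k = 2" | "k \<ge> 3" by linarith
    then have "pot c U \<ge> (int i + 1) * int k"
    proof cases
      case 1
      then have "k = 0 \<or> k = 1" by linarith
      then show ?thesis using big by auto
    next
      case 2
      show ?thesis
      proof (cases "c v False = i + 1 \<and> c v True = i + 2")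
        case True
        \<comment> \<open>Equality would be the excluded case of degree 2, so
          \<open>insert v U\<close> is proper and its potential supplies the missing unit.\<close>
        have "U \<noteq> V - {v}" using True notfull 2 by (auto simp: k_def)
        then have "insert v U \<subset> V" using U(2) v by blast
        then have "pot c (insert v U) \<ge> 1"
          using proper_pot_ge_double[of "insert v U"] by simp
        then show ?thesis using ins full 2 by (simp add: algebra_simps)
      next
        case False
        then have "vpot c v \<le> 2 * (int i)\<^sup>2 + 4 * int i"
          unfolding vpot_def by (rule cap_potential_less_full[OF i_pos cap_le(1)[OF v] cap_le(2)[OF v]])
        then show ?thesis using ins nonneg 2 by (simp add: algebra_simps)
      qed
    next
      case 3
      then have "((int i)\<^sup>2 + 2 * int i) * int k \<ge> ((int i)\<^sup>2 + 2 * int i) * 3"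
        by (intro mult_left_mono) auto
      moreover have "int i * int i \<ge> 1" using i_pos mult_mono[of 1 "int i" 1 "int i"] by simp
      ultimately show ?thesis
        using ins nonneg full by (simp add: algebra_simps power2_eq_square)
    qed
    with p show "0 \<le> pot c' U" by simp
  qed (auto simp: c'_def)
  then obtain \<psi> where \<psi>: "good c' ?T \<psi>" using smaller[of ?T c'] v by blast
  have u: "conflicts \<psi> ?T (\<psi> u) u + w u v (\<psi> u = b) < c u (\<psi> u)" if "u \<in> ?T" for u
    using \<psi> that by (force simp: good_def c'_def)
  have ge: "c v b \<le> conflicts \<psi> ?T b v"
    using not_good_insert[OF v _ u] by (meson not_less)
  then show "c v b \<le> cross ?T {v}"
    using conflicts_le_cross[of \<psi> ?T b v] by simp
  assume pos: "c v (\<not> b) \<ge> 1"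
  show "c v b < cross ?T {v}"
  proof (rule ccontr)
    assume "\<not> c v b < cross ?T {v}"
    then have zero: "conflicts \<psi> ?T (\<not> b) v = 0"
      using ge conflicts_both[of \<psi> ?T v] by (cases b) auto
    show False
    proof (rule not_good_insert[OF v])
      show "conflicts \<psi> ?T (\<not> b) v < c v (\<not> b)" using zero pos by simp
      fix u assume u': "u \<in> ?T"
      then have "w u v (\<psi> u = (\<not> b)) = 0"
        using weight_le_conflicts[of ?T u v \<psi> "\<not> b"] zero fin by simp
      then show "conflicts \<psi> ?T (\<psi> u) u + w u v (\<psi> u = (\<not> b)) < c u (\<psi> u)"
        using u[OF u'] by simp
    qed
  qed
qed

text \<open>Lowering both capacities of a neighbour \<open>x\<close> by one costs at most
  \<open>2 * i + 1\<close>, which proper sets can spare. Then \<open>v\<close> can take a colour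
  whose only possible conflict is one edge to \<open>x\<close>.\<close>

lemma full_degree_neq_2:
  assumes v: "v \<in> V" and full: "c v False = i + 1" "c v True = i + 2"
  shows "cross (V - {v}) {v} \<noteq> 2"
proof
  assume two: "cross (V - {v}) {v} = 2"
  let ?T = "V - {v}"
  have sum: "(\<Sum>u\<in>?T. emult u v) = 2" using two by (simp add: cross_def)
  then obtain x where x: "x \<in> ?T" "emult x v \<noteq> 0"
    by (metis sum.neutral zero_neq_numeral)
  define c' where "c' u d = (if u = x then c u d - 1 else c u d)" for u and d :: bool
  have "admissible c' ?T"
  proof (rule admissible_reduce[OF adm])
    fix U assume U: "U \<noteq> {}" "U \<subseteq> ?T"
    have fU: "finite U" "U \<subset> V" using fin_subset[of U] U v by auto
    have "pot c' U \<ge> pot c U - (\<Sum>u\<in>U. if u = x then 2 * int i + 1 else 0)"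
      by (rule pot_change)
        (use cap_potential_diff_both[OF i_pos] in \<open>auto simp: vpot_def c'_def\<close>)
    moreover have "(\<Sum>u\<in>U. if u = x then 2 * int i + 1 else 0) \<le> 2 * int i + 1"
      using fU by simp
    moreover have "pot c U \<ge> 2 * int i + 1" using proper_pot_ge_double fU U by auto
    ultimately show "0 \<le> pot c' U" by linarith
  qed (auto simp: c'_def)
  then obtain \<psi> where \<psi>: "good c' ?T \<psi>" using smaller[of ?T c'] v by blast
  have fin': "finite (?T - {x})" using fin by simp
  have parts: "cross ?T {v} = emult x v + cross (?T - {x}) {v}"
    using sum.remove[of ?T x "\<lambda>u. emult u v"] x fin by (simp add: cross_def)
  have cparts: "conflicts \<psi> ?T b v = w x v (\<psi> x = b) + conflicts \<psi> (?T - {x}) b v" for b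
    using sum.remove[of ?T x "\<lambda>u. w u v (\<psi> u = b)"] x fin by (simp add: conflicts_def)
  have both: "w x v (\<psi> x = True) + w x v (\<psi> x = False) = emult x v"
    by (cases "\<psi> x") (auto simp: emult_def)
  \<comment> \<open>With one edge to \<open>x\<close>, the colour avoids a conflict on the other
    edge; with two, some colour has at most one conflict.\<close>
  have "\<exists>b. conflicts \<psi> (?T - {x}) b v = 0 \<and> w x v (\<psi> x = b) \<le> 1"
  proof (cases "emult x v = 1")
    case True
    have "w x v (\<psi> x = b) \<le> 1" for b using both True by (cases b) auto
    moreover have "cross (?T - {x}) {v} = 1" using parts two True by simp
    then have "\<exists>b. conflicts \<psi> (?T - {x}) b v = 0"
      using conflicts_both[of \<psi> "?T - {x}" v] by (auto simp: add_is_1)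
    ultimately show ?thesis by blast
  next
    case False
    then have "cross (?T - {x}) {v} = 0" "emult x v = 2" using parts two x by auto
    then have "conflicts \<psi> (?T - {x}) b v = 0" for b
      using conflicts_le_cross[of \<psi> "?T - {x}" b v] by simp
    moreover have "w x v (\<psi> x = True) \<le> 1 \<or> w x v (\<psi> x = False) \<le> 1"
      using both \<open>emult x v = 2\<close> by linarith
    ultimately show ?thesis by blast
  qed
  then obtain b where b: "conflicts \<psi> (?T - {x}) b v = 0" "w x v (\<psi> x = b) \<le> 1" by blast
  show False
  proof (rule not_good_insert[OF v])
    \<comment> \<open>One conflict is allowed because both capacities of \<open>v\<close> are at
      least 2.\<close>
    show "conflicts \<psi> ?T b v < c v b"
      using cparts[of b] b full i_pos by (cases b) auto
    fix u assume u: "u \<in> ?T"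
    then have g: "conflicts \<psi> ?T (\<psi> u) u < c' u (\<psi> u)" using \<psi> by (simp add: good_def)
    show "conflicts \<psi> ?T (\<psi> u) u + w u v (\<psi> u = b) < c u (\<psi> u)"
    proof (cases "u = x")
      case True
      then show ?thesis using g b(2) by (simp add: c'_def)
    next
      case False
      then have "w u v (\<psi> u = b) = 0"
        using weight_le_conflicts[OF fin', of u v \<psi> b] u b(1) by simp
      then show ?thesis using g False by (simp add: c'_def)
    qed
  qed
qed

section \<open>Discharging\<close>

text \<open>By \<open>double_pot\<close>, \<open>2 * pot c V\<close> is the sum of the vertex
  charges, and the degree bounds make each of them negative.\<close>

lemma contradiction: False
proof -
  have "2 * vpot c v - edge_cost * int (cross {v} V) < 0" if v: "v \<in> V" for v
  proof -
    have "cross V {v} = cross (V - {v}) {v}"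
      using sum.remove[OF fin v, of "\<lambda>u. emult u v"] by (simp add: cross_def emult_irrefl)
    then have d: "cross {v} V = cross (V - {v}) {v}" by (simp add: cross_sym)
    have notfull: "\<not> (c v False = i + 1 \<and> c v True = i + 2 \<and> cross (V - {v}) {v} = 2)"
      using full_degree_neq_2[OF v] by blast
    have "0 \<le> vpot c v" using pot_nonneg[of "{v}"] v by (simp add: pot_singleton)
    \<comment> \<open>With both capacities 0, the correction term would make the potential of
      \<open>{v}\<close> equal to -1.\<close>
    then have pos: "c v False \<ge> 1 \<or> c v True \<ge> 1"
      by (cases "c v False") (auto simp: vpot_def cap_potential_def split: if_splits)
    have "2 * vpot c v < edge_cost * int (cross (V - {v}) {v})"
      unfolding vpot_def
      using degree_gt[OF v notfull, of True] degree_gt[OF v notfull, of False]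
      by (intro cap_potential_discharge[OF i_pos cap_le(1)[OF v] cap_le(2)[OF v] pos]) auto
    then show ?thesis using d by simp
  qed
  moreover have "V \<noteq> {}" using uncol by (auto simp: good_def)
  ultimately have "2 * pot c V < 0"
    unfolding double_pot[OF fin]
    using sum_strict_mono[OF fin, of "\<lambda>v. 2 * vpot c v - edge_cost * int (cross {v} V)" "\<lambda>_. 0"]
    by simp
  moreover have "0 \<le> pot c V" using pot_nonneg \<open>V \<noteq> {}\<close> by blast
  ultimately show False by simp
qed

end

theorem (in signed_graph) admissible_imp_good:
  assumes "finite V" "admissible c V"
  shows "\<exists>\<phi>. good c V \<phi>"
  using assms
proof (induction V arbitrary: c rule: finite_psubset_induct)
  case (psubset V)
  show ?case
  proof (rule ccontr)
    assume "\<nexists>\<phi>. good c V \<phi>"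
    then interpret minimal_counterexample i w V c
      using psubset by unfold_locales blast+
    show False by (rule contradiction)
  qed
qed

section \<open>From covers to signed graphs\<close>

text \<open>A perfect matching between two lists is parallel (sign \<open>True\<close>) or crossed
  (sign \<open>False\<close>). Repeated matchings coincide in a simple graph, hence weight at most 1
  per sign; one edge of a matching already counts.\<close>

definition cover_weight ::
    "'v multigraph \<Rightarrow> ('v, 'w) cover \<Rightarrow> 'v \<Rightarrow> 'v \<Rightarrow> bool \<Rightarrow> nat" where
  "cover_weight G C u v s = of_bool (u \<in> verts G \<and> v \<in> verts G \<and> u \<noteq> v \<and>
     (if s then {poor C u, poor C v} \<in> sedges (cgraph C) \<or> {rich C u, rich C v} \<in> sedges (cgraph C)
      else {poor C u, rich C v} \<in> sedges (cgraph C) \<or> {rich C u, poor C v} \<in> sedges (cgraph C)))"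

lemma signed_graph_cover_weight: "i \<ge> 1 \<Longrightarrow> signed_graph i (cover_weight G C)"
  by unfold_locales (auto simp: cover_weight_def insert_commute)

lemma perfect_matching_unique:
  "perfect_matching_between A B M \<Longrightarrow> x \<in> A \<union> B \<Longrightarrow> e \<in> M \<Longrightarrow> f \<in> M \<Longrightarrow> x \<in> e \<Longrightarrow> x \<in> f \<Longrightarrow> e = f"
  unfolding perfect_matching_between_def by blast

text \<open>Lists of nonadjacent vertices are not joined, so the critical case is multiplicity one
  with both signs present. Then the edges form a single perfect matching, but a parallel and a
  crossed edge always share an end.\<close>

lemma cover_weight_le_count:
  assumes C: "two_fold_cover G C" and uv: "u \<in> verts G" "v \<in> verts G" "u \<noteq> v"
  shows "cover_weight G C u v True + cover_weight G C u v False \<le> count (edges G) {u, v}"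
proof -
  let ?B = "edges_between (cgraph C) (L C u) (L C v)"
  have w: "\<exists>a\<in>L C u. \<exists>b\<in>L C v. {a, b} \<in> ?B" if "cover_weight G C u v s > 0" for s
    using that by (cases s) (auto simp: cover_weight_def edges_between_def L_def)
  have le1: "cover_weight G C u v s \<le> 1" for s by (simp add: cover_weight_def)
  show ?thesis
  proof (cases "?B = {}")
    case True
    then have "cover_weight G C u v s = 0" for s using w[of s] by fastforce
    then show ?thesis by simp
  next
    case False
    then have "{u, v} \<in># edges G" using C uv unfolding two_fold_cover_def by blast
    then have cnt: "count (edges G) {u, v} \<ge> 1" by (simp add: Suc_le_eq)
    then obtain \<M> where \<M>: "finite \<M>" "card \<M> \<le> count (edges G) {u, v}"
      "\<forall>M\<in>\<M>. perfect_matching_between (L C u) (L C v) M" "?B = \<Union>\<M>"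
      using conjunct2[OF C[unfolded two_fold_cover_def]] uv by metis
    show ?thesis
    proof (rule ccontr)
      assume "\<not> ?thesis"
      then have cnt1: "count (edges G) {u, v} = 1"
        and pos: "cover_weight G C u v True > 0" "cover_weight G C u v False > 0"
        using le1[of True] le1[of False] cnt by linarith+
      have "\<M> \<noteq> {}" using False \<M>(4) by auto
      then have "card \<M> = 1" using \<M>(1,2) cnt1 by (simp add: le_antisym Suc_le_eq card_gt_0_iff)
      then obtain M where "\<M> = {M}" by (auto simp: card_1_singleton_iff)
      then have M: "perfect_matching_between (L C u) (L C v) ?B" using \<M>(3,4) by auto
      have ne: "poor C u \<noteq> rich C u" "poor C v \<noteq> rich C v"
        using C uv unfolding two_fold_cover_def by auto
      have "{poor C u, poor C v} \<in> ?B \<or> {rich C u, rich C v} \<in> ?B"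
        "{poor C u, rich C v} \<in> ?B \<or> {rich C u, poor C v} \<in> ?B"
        using pos by (auto simp: cover_weight_def edges_between_def L_def)
      then obtain x e f where "x \<in> L C u \<union> L C v" "e \<in> ?B" "f \<in> ?B" "x \<in> e" "x \<in> f"
        and ef: "e \<in> {{poor C u, poor C v}, {rich C u, rich C v}}"
          "f \<in> {{poor C u, rich C v}, {rich C u, poor C v}}"
        unfolding L_def by blast
      then have "e = f" using perfect_matching_unique[OF M] by blast
      with ef ne show False by (elim insertE emptyE) (simp_all add: doubleton_eq_iff)
    qed
  qed
qed

lemma size_filter_member:
  assumes "finite X"
  shows "size {#e \<in># M. e \<in> X#} = (\<Sum>e\<in>X. count M e)"
proof (induction M)
  case (add x M)
  have "(\<Sum>e\<in>X. count (add_mset x M) e) = (\<Sum>e\<in>X. (if e = x then 1 else 0) + count M e)"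
    by (intro sum.cong) auto
  also have "\<dots> = (if x \<in> X then 1 else 0) + (\<Sum>e\<in>X. count M e)"
    using assms by (simp add: sum.distrib)
  finally show ?case using add by simp
qed simp

lemma size_filter_subset_insert:
  assumes "finite S" "v \<notin> S"
  shows "size {#e \<in># M. e \<subseteq> S#} + (\<Sum>u\<in>S. count M {u, v}) \<le> size {#e \<in># M. e \<subseteq> insert v S#}"
proof -
  let ?X = "(\<lambda>u. {u, v}) ` S"
  have "inj_on (\<lambda>u. {u, v}) S" using assms(2) by (auto simp: inj_on_def doubleton_eq_iff)
  then have "(\<Sum>u\<in>S. count M {u, v}) = size {#e \<in># M. e \<in> ?X#}"
    using assms(1) by (simp add: size_filter_member sum.reindex)
  moreover have "{#e \<in># M. e \<subseteq> S#} + {#e \<in># M. e \<in> ?X#} \<subseteq># {#e \<in># M. e \<subseteq> insert v S#}"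
    using assms(2) by (intro mset_subset_eqI) auto
  from size_mset_mono[OF this]
  have "size {#e \<in># M. e \<subseteq> S#} + size {#e \<in># M. e \<in> ?X#} \<le> size {#e \<in># M. e \<subseteq> insert v S#}"
    by simp
  ultimately show ?thesis by simp
qed

text \<open>Vertices are added one by one. An inequality suffices, since fewer edges only raise
  potentials.\<close>

lemma num_edges_le_size:
  fixes i :: nat
  assumes i: "i \<ge> 1" and C: "two_fold_cover G C" and "finite S" "S \<subseteq> verts G"
  shows "signed_graph.num_edges (cover_weight G C) S \<le> size (edges (induced_multigraph G S))"
  using assms(3,4)
proof (induction S rule: finite_induct)
  interpret signed_graph i "cover_weight G C" by (rule signed_graph_cover_weight[OF i])
  {
    case empty
    show ?case by (simp add: num_edges_empty)
  next
    case (insert v S)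
    have "(\<Sum>u\<in>S. emult u v) \<le> (\<Sum>u\<in>S. count (edges G) {u, v})"
      using insert cover_weight_le_count[OF C] unfolding emult_def
      by (intro sum_mono) auto
    then show ?case
      using insert size_filter_subset_insert[of S v "edges G"]
      by (simp add: num_edges_insert induced_multigraph_def)
  }
qed

text \<open>In terms of the capacities \<open>a\<close> and \<open>b\<close>, the two sides agree
  for \<open>a < b\<close>; otherwise the right side is larger by \<open>a - b\<close>.\<close>

lemma vertex_potential_le:
  assumes "t_p t v \<le> i + 1" "t_r t v \<le> i + 2"
  shows "vertex_potential i t v \<le> cap_potential i (i + 1 - t_p t v) (i + 2 - t_r t v)"
proof -
  obtain a b where a: "i + 1 = t_p t v + a" and b: "i + 2 = t_r t v + b"
    using assms le_Suc_ex by metis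
  then have ab: "i + 1 - t_p t v = a" "i + 2 - t_r t v = b" by auto
  have t: "int (t_p t v) = int i + 1 - int a" "int (t_r t v) = int i + 2 - int b"
    using a b by linarith+
  \<comment> \<open>Strict because the rich capacity starts from \<open>i + 2\<close> and the poor
    one from \<open>i + 1\<close>.\<close>
  have "t_r t v \<le> t_p t v \<longleftrightarrow> a < b" using a b by linarith
  then show ?thesis
    unfolding vertex_potential_def cap_potential_def ab t
    by (auto simp: algebra_simps power2_eq_square)
qed

text \<open>An edge at \<open>\<phi> v\<close> within the image leads to \<open>\<phi> u\<close> for
  another vertex \<open>u\<close>, and its presence makes the weight of sign
  \<open>\<chi> u = \<chi> v\<close> equal to 1.\<close>

lemma degree_chosen_le:
  assumes C: "two_fold_cover G C" and fin: "finite (verts G)" and v: "v \<in> verts G"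
    and \<phi>: "\<phi> = (\<lambda>v. if \<chi> v then rich C v else poor C v)"
  shows "degree (chosen_subgraph G C \<phi>) (\<phi> v) \<le> (\<Sum>u\<in>verts G. cover_weight G C u v (\<chi> u = \<chi> v))"
proof -
  let ?N = "{u \<in> verts G. u \<noteq> v \<and> {\<phi> u, \<phi> v} \<in> sedges (cgraph C)}"
  have "{e \<in> sedges (chosen_subgraph G C \<phi>). \<phi> v \<in> e} \<subseteq> (\<lambda>u. {\<phi> u, \<phi> v}) ` ?N"
  proof
    fix e assume "e \<in> {e \<in> sedges (chosen_subgraph G C \<phi>). \<phi> v \<in> e}"
    then have e: "e \<in> sedges (cgraph C)" "e \<subseteq> \<phi> ` verts G" "\<phi> v \<in> e"
      by (auto simp: chosen_subgraph_def induced_sgraph_def)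
    then have "card e = 2" using C by (auto simp: two_fold_cover_def sgraph_def)
    then obtain z where z: "e = {z, \<phi> v}" "z \<noteq> \<phi> v"
      using e(3) by (auto simp: card_2_iff insert_commute)
    then obtain u where "u \<in> verts G" "z = \<phi> u" using e(2) by auto
    then show "e \<in> (\<lambda>u. {\<phi> u, \<phi> v}) ` ?N" using z e(1) by blast
  qed
  then have "degree (chosen_subgraph G C \<phi>) (\<phi> v) \<le> card ((\<lambda>u. {\<phi> u, \<phi> v}) ` ?N)"
    unfolding degree_def using fin by (intro card_mono) auto
  also have "\<dots> \<le> card ?N" using fin by (intro card_image_le) auto
  also have "\<dots> = (\<Sum>u\<in>?N. 1)" by simp
  also have "\<dots> \<le> (\<Sum>u\<in>?N. cover_weight G C u v (\<chi> u = \<chi> v))"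
    using v by (intro sum_mono) (auto simp: cover_weight_def \<phi> split: if_splits)
  also have "\<dots> \<le> (\<Sum>u\<in>verts G. cover_weight G C u v (\<chi> u = \<chi> v))"
    using fin by (intro sum_mono2) auto
  finally show ?thesis .
qed

text \<open>If the potential were nonnegative, the capacities would be admissible for the signed
  graph of an uncolourable cover, and a good colouring of it would colour that cover.\<close>

theorem theorem9p3:
  fixes i j :: nat and G :: "'v multigraph" and t :: "'v toughness"
  assumes "i \<ge> 1" and "j = i + 1"
    and "multigraph G" and "toughness i j G t"
    and "critical TYPE('w) i j G t"
  shows "potential i G t \<le> -1"
proof (rule ccontr)
  assume neg: "\<not> potential i G t \<le> -1"
  have fin: "finite (verts G)" using assms(3) by (simp add: multigraph_def)
  obtain C :: "('v, 'w) cover" where C: "two_fold_cover G C" "\<And>\<phi>. \<not> coloring i j t G C \<phi>"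
    using assms(5) unfolding critical_def by blast
  interpret signed_graph i "cover_weight G C"
    by (rule signed_graph_cover_weight[OF assms(1)])
  \<comment> \<open>Degree bounds plus one, with \<open>j + 1 = i + 2\<close> for rich; by toughness
    the subtractions do not truncate.\<close>
  define c where "c v b = (if b then i + 2 - t_r t v else i + 1 - t_p t v)" for v b
  have tough: "t_p t v \<le> i + 1" "t_r t v \<le> i + 2" if "v \<in> verts G" for v
    using assms(2,4) that by (auto simp: toughness_def)
  have "admissible c (verts G)"
    unfolding admissible_def
  proof (intro conjI allI impI)
    fix U assume U: "U \<noteq> {}" "U \<subseteq> verts G"
    have "finite (set_potential i G t ` {S. S \<noteq> {} \<and> S \<subseteq> verts G})"
      using fin by simp
    then have "potential i G t \<le> set_potential i G t U"
      unfolding potential_def using U by (intro Min_le) auto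
    with neg have "0 \<le> set_potential i G t U" by linarith
    also have "\<dots> \<le> pot c U"
    proof -
      have "(\<Sum>v\<in>U. vertex_potential i t v) \<le> (\<Sum>v\<in>U. vpot c v)"
      proof (rule sum_mono)
        fix v assume "v \<in> U"
        then show "vertex_potential i t v \<le> vpot c v"
          using U vertex_potential_le[of t v i] tough[of v] by (auto simp: vpot_def c_def)
      qed
      moreover have "edge_cost * int (num_edges U)
          \<le> edge_cost * int (size (edges (induced_multigraph G U)))"
        using num_edges_le_size[OF assms(1) C(1)] U fin finite_subset
        by (intro mult_left_mono) auto
      ultimately show ?thesis unfolding set_potential_def pot_def by linarith
    qed
    finally show "0 \<le> pot c U" .
  qed (auto simp: c_def)
  then obtain \<chi> where \<chi>: "good c (verts G) \<chi>" using admissible_imp_good[OF fin] by blast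
  define \<phi> where "\<phi> = (\<lambda>v. if \<chi> v then rich C v else poor C v)"
  have "coloring i j t G C \<phi>"
    unfolding coloring_def
  proof (intro conjI ballI impI)
    show "cover_map G C \<phi>" by (auto simp: cover_map_def L_def \<phi>_def)
    fix v assume v: "v \<in> verts G"
    have ne: "poor C v \<noteq> rich C v" using C(1) v by (auto simp: two_fold_cover_def)
    have d: "degree (chosen_subgraph G C \<phi>) (\<phi> v) < c v (\<chi> v)"
      using degree_chosen_le[OF C(1) fin v \<phi>_def] \<chi> v
      unfolding good_def conflicts_def by (meson le_less_trans)
    show "int (degree (chosen_subgraph G C \<phi>) (\<phi> v)) \<le> int i - int (t_p t v)"
      if "\<phi> v = poor C v"
    proof -
      have "\<not> \<chi> v" using that ne by (auto simp: \<phi>_def)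
      then show ?thesis using d by (simp add: c_def)
    qed
    show "int (degree (chosen_subgraph G C \<phi>) (\<phi> v)) \<le> int j - int (t_r t v)"
      if "\<phi> v = rich C v"
    proof -
      have "\<chi> v" using that ne by (auto simp: \<phi>_def split: if_splits)
      then show ?thesis using d assms(2) by (simp add: c_def)
    qed
  qed
  then show False using C(2) by blast
qed

end
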